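(* Let $p>0$ and let $\{X_t\}_{t\in\mathbb{N}}$ be the Markov chain on $(0,1)$ in which, given $X_{t-1}=x\in(0,1)$, the next state $X_t$ is uniform on $(0,x)$ with probability $\frac{x^p}{x^p+(1-x)^p}$ and uniform on $(x,1)$ with probability $\frac{(1-x)^p}{x^p+(1-x)^p}$. Then, from any starting distribution on $(0,1)$, the law of $X_t$ converges in total variation distance, as $t\to\infty$, to the stationary distribution of the chain, which has density $$\rho(x)=\frac1{Z_p}\left(\frac{2}{x^p+(1-x)^p}\right)^{1/p}\mathbf 1_{x\in(0,1)},$$ where $Z_p\in(2\log 2,\pi)$ is a constant depending on $p$.
   Context: Equivalently, the chain has transition kernel $K_p(s,x)=\frac{x^{p-1}}{x^p+(1-x)^p}\mathbf 1_{0<s<x}+\frac{(1-x)^{p-1}}{x^p+(1-x)^p}\mathbf 1_{x<s<1}$, where $x$ is the current state and $s\mapsto K_p(s,x)$ is the density of the next state. A density $\rho$ is stationary if $\rho(s)=\int_0^1K_p(s,x)\rho(x)\,dx$ for almost every $s$. Here $\log$ is the natural logarithm. *)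

theory Defs
  imports "HOL-Probability.Probability"
begin

text \<open>
  The law of the next state, given that the current state is \<open>x\<close>: flip a coin whose success
  probability is \<open>x\<^sup>p / (x\<^sup>p + (1 - x)\<^sup>p)\<close>, and then draw uniformly from \<open>(0, x)\<close> on success and
  from \<open>(x, 1)\<close> on failure.  Only its values for \<open>x \<in> (0, 1)\<close> are meaningful.
\<close>

definition step :: "real \<Rightarrow> real \<Rightarrow> real measure" where
  "step p x =
     measure_pmf (bernoulli_pmf (x powr p / (x powr p + (1 - x) powr p))) \<bind>
       (\<lambda>left. uniform_measure lborel (if left then {0<..<x} else {x<..<1}))"

definition kernel :: "real \<Rightarrow> real \<Rightarrow> real \<Rightarrow> real" where
  "kernel p s x =
     x powr (p - 1) / (x powr p + (1 - x) powr p) * of_bool (0 < s \<and> s < x) +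
     (1 - x) powr (p - 1) / (x powr p + (1 - x) powr p) * of_bool (x < s \<and> s < 1)"

definition history :: "'a measure \<Rightarrow> (nat \<Rightarrow> 'a \<Rightarrow> real) \<Rightarrow> nat \<Rightarrow> 'a measure" where
  "history M X t =
     vimage_algebra (space M) (\<lambda>\<omega>. \<lambda>i\<in>{..t}. X i \<omega>) (\<Pi>\<^sub>M i\<in>{..t}. borel)"

text \<open>
  The last condition is the Markov property with transition law \<^const>\<open>step\<close>: almost surely,
  \<open>P(X\<^bsub>t+1\<^esub> \<in> B | X\<^sub>0, \<dots>, X\<^sub>t) = step p X\<^sub>t B\<close>.  The law of \<open>X\<^sub>0\<close> is an arbitrary distribution
  on \<open>(0, 1)\<close>.
\<close>

definition markov_chain :: "real \<Rightarrow> 'a measure \<Rightarrow> (nat \<Rightarrow> 'a \<Rightarrow> real) \<Rightarrow> bool" where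
  "markov_chain p M X \<longleftrightarrow>
     prob_space M \<and>
     (\<forall>t. X t \<in> borel_measurable M) \<and>
     (\<forall>t. \<forall>\<omega>\<in>space M. X t \<omega> \<in> {0<..<1}) \<and>
     (\<forall>t. \<forall>B\<in>sets borel. AE \<omega> in M.
        real_cond_exp M (history M X t) (\<lambda>\<omega>. indicator B (X (Suc t) \<omega>)) \<omega> =
        measure (step p (X t \<omega>)) B)"

definition tv_dist :: "'a measure \<Rightarrow> 'a measure \<Rightarrow> real" where
  "tv_dist \<mu> \<nu> = (SUP A\<in>sets \<mu>. \<bar>measure \<mu> A - measure \<nu> A\<bar>)"

text \<open>
  Integrability is required explicitly because the integral of a non-integrable function is \<open>0\<close>
  by convention.
\<close>

definition stationary_density :: "real \<Rightarrow> (real \<Rightarrow> real) \<Rightarrow> bool" where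
  "stationary_density p \<rho> \<longleftrightarrow>
     \<rho> \<in> borel_measurable borel \<and>
     (\<forall>x. 0 \<le> \<rho> x) \<and>
     (\<forall>x. x \<notin> {0<..<1} \<longrightarrow> \<rho> x = 0) \<and>
     prob_space (density lborel \<rho>) \<and>
     (AE s in lborel.
        set_integrable lborel {0<..<1} (\<lambda>x. kernel p s x * \<rho> x) \<and>
        \<rho> s = (LINT x:{0<..<1}|lborel. kernel p s x * \<rho> x))"

definition stationary_distribution :: "real \<Rightarrow> real measure \<Rightarrow> bool" where
  "stationary_distribution p \<mu> \<longleftrightarrow>
     prob_space \<mu> \<and> sets \<mu> = sets borel \<and> emeasure \<mu> {0<..<1} = 1 \<and>
     (\<forall>B\<in>sets borel. emeasure \<mu> B = (\<integral>\<^sup>+x. emeasure (step p x) B \<partial>\<mu>))"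

definition rho :: "real \<Rightarrow> real \<Rightarrow> real \<Rightarrow> real" where
  "rho p Z x =
     1 / Z * (2 / (x powr p + (1 - x) powr p)) powr (1 / p) * indicator {0<..<1} x"

end

theory Submission
  imports Defs
begin

text \<open>
  With \<open>D x = x powr p + (1 - x) powr p\<close> and \<open>w = (2 / D) powr (1 / p)\<close>, the two halves of the
  stationarity integral have explicit antiderivatives, \<open>x * w x\<close> and \<open>(x - 1) * w x\<close>; they add up
  to \<open>s * w s + (1 - s) * w s = w s\<close>.  The value \<open>1 / w x\<close> is the power mean with exponent \<open>p\<close> of \<open>x\<close>
  and \<open>1 - x\<close>, which lies between their geometric mean and their maximum; integrating gives
  the bounds on \<open>Z\<close>.  The kernel is at least \<open>(1 / 3) powr p / 2\<close> for \<open>s\<close> in \<open>(1/3, 2/3)\<close>, whatever the current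
  state (Doeblin's condition), so one step contracts differences of laws in total variation by
  a factor \<open>1 - (1 / 3) powr p / 6\<close>, which yields both uniqueness and convergence.
\<close>

section \<open>Strict positivity of integrals\<close>

text \<open>Setting \<open>h\<close> to zero outside the good points changes it on a negligible set
  and makes it nonnegative, so the gauge integral becomes a Lebesgue integral. If that vanished,
  \<open>h\<close> would fail to be positive almost everywhere on an interval of positive length.
  The set \<open>S\<close> leaves room for points where two compared functions touch.\<close>

lemma has_integral_pos_of_pos:
  fixes h :: "real \<Rightarrow> real"
  assumes h: "(h has_integral I) {a..b}" and "a < b" and S: "finite S"
    and pos: "\<And>x. x \<in> {a<..<b} - S \<Longrightarrow> 0 < h x"
    and [measurable]: "h \<in> borel_measurable borel"
  shows "0 < I"
proof -
  define g where "g x = (if x \<in> {a<..<b} - S then h x else 0)" for x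
  have g_nonneg: "0 \<le> g x" for x
    using pos[of x] by (auto simp: g_def)
  have [measurable]: "S \<in> sets borel"
    using S by (simp add: finite_imp_closed)
  have g_meas [measurable]: "g \<in> borel_measurable borel"
    unfolding g_def by measurable
  have "negligible ({a..b} - ({a<..<b} - S))"
  proof (rule negligible_subset)
    show "negligible (insert a (insert b S))"
      using S by (intro negligible_finite) auto
  qed auto
  then have "(g has_integral I) {a..b}"
    by (rule has_integral_spike) (use h in \<open>auto simp: g_def\<close>)
  then have "((\<lambda>x. if x \<in> {a..b} then g x else 0) has_integral I) UNIV"
    by (simp only: has_integral_restrict_UNIV)
  moreover have "(\<lambda>x. if x \<in> {a..b} then g x else 0) = g"
    by (auto simp: g_def)
  ultimately have gI: "(g has_integral I) UNIV"
    by simp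
  have nn: "(\<integral>\<^sup>+x. g x \<partial>lborel) = I"
    using gI g_nonneg g_meas by (intro nn_integral_has_integral_lborel) auto
  have "0 \<le> I"
    using has_integral_nonneg[OF gI] g_nonneg by auto
  moreover have "I \<noteq> 0"
  proof
    assume "I = 0"
    then have "AE x in lborel. ennreal (g x) = 0"
      using nn by (simp add: nn_integral_0_iff_AE)
    moreover have "AE x in lborel. x \<notin> S"
      by (rule AE_not_in) (use S in \<open>auto simp: finite_imp_null_set_lborel\<close>)
    ultimately have "AE x in lborel. x \<notin> {a<..<b}"
    proof eventually_elim
      case (elim x)
      then have "\<not> 0 < g x" by (simp add: ennreal_eq_0_iff not_less)
      with pos[of x] elim(2) show ?case by (auto simp: g_def split: if_splits)
    qed
    then have "emeasure lborel {a<..<b} = 0"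
      by (subst (asm) AE_iff_measurable[of "{a<..<b}"]) auto
    with \<open>a < b\<close> show False by simp
  qed
  ultimately show ?thesis by simp
qed

section \<open>The unnormalised density and its antiderivative identities\<close>

definition profile :: "real \<Rightarrow> real \<Rightarrow> real" where
  "profile p x = (2 / (x powr p + (1 - x) powr p)) powr (1 / p)"

lemma rho_eq_profile: "rho p Z x = 1 / Z * profile p x * indicator {0<..<1} x"
  by (simp add: rho_def profile_def)

lemma profile_measurable [measurable]: "profile p \<in> borel_measurable borel"
  unfolding profile_def by measurable

text \<open>Away from 0, \<open>powr\<close> is an exponential and hence positive even at negative
  arguments, and at most one of the two terms can vanish. So denominators need no restriction to the
  unit interval.\<close>

lemma powr_sum_pos:
  fixes x :: real
  shows "0 < x powr p + (1 - x) powr p"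
proof (cases "x = 0")
  case False
  then have "0 < x powr p" by simp
  then show ?thesis by (simp add: add_pos_nonneg)
qed simp

lemma profile_nonneg: "0 \<le> profile p x"
  by (simp add: profile_def)

lemma profile_continuous_on:
  assumes "0 < p"
  shows "continuous_on {0..1} (profile p)"
  unfolding profile_def
proof (intro continuous_on_powr' continuous_intros)
  show "\<forall>x\<in>{0..1}. x powr p + (1 - x) powr p \<noteq> 0"
    using powr_sum_pos by (metis less_irrefl)
  show "\<forall>x\<in>{0..1}. 0 \<le> 2 / (x powr p + (1 - x) powr p) \<and>
      (2 / (x powr p + (1 - x) powr p) = 0 \<longrightarrow> 0 < 1 / p)"
    using assms by auto
qed (use assms in auto)

lemma profile_has_derivative:
  assumes "0 < p" and x: "x \<in> {0<..<1}"
  shows "(profile p has_real_derivative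
    profile p x * ((1 - x) powr (p - 1) - x powr (p - 1)) / (x powr p + (1 - x) powr p)) (at x)"
proof -
  define D where "D = x powr p + (1 - x) powr p"
  have D: "0 < D" unfolding D_def by (rule powr_sum_pos)
  have E: "(\<lambda>x. x powr p + (1 - x) powr p) x = D" by (simp add: D_def)
  have dD: "((\<lambda>x. x powr p + (1 - x) powr p) has_real_derivative
      p * (x powr (p - 1) - (1 - x) powr (p - 1))) (at x)"
  proof (rule DERIV_cong[OF DERIV_add])
    show "((\<lambda>x. x powr p) has_real_derivative p * x powr (p - 1)) (at x)"
      using x by (intro has_real_derivative_powr) auto
    show "((\<lambda>x. (1 - x) powr p) has_real_derivative p * (1 - x) powr (p - 1) * (- 1)) (at x)"
      using x by (intro DERIV_chain2[OF has_real_derivative_powr]) (auto intro!: derivative_eq_intros)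
  qed (simp add: algebra_simps)
  have "((\<lambda>x. 2 / (x powr p + (1 - x) powr p)) has_real_derivative
      - 2 * (p * (x powr (p - 1) - (1 - x) powr (p - 1))) / (D * D)) (at x)"
    by (rule DERIV_cong[OF DERIV_divide[OF DERIV_const dD]]) (use D in \<open>auto simp: D_def\<close>)
  then have "(profile p has_real_derivative
      (1 / p) * (2 / D) powr (1 / p - 1) *
        (- 2 * (p * (x powr (p - 1) - (1 - x) powr (p - 1))) / (D * D))) (at x)"
    unfolding profile_def using D
    by (intro has_real_derivative_powr[THEN DERIV_chain2, THEN DERIV_cong]) (auto simp: D_def)
  then show ?thesis
  proof (rule DERIV_cong)
    have "(2 / D) powr (1 / p - 1) = profile p x * D / 2"
      using D by (simp add: powr_diff profile_def D_def)
    then show "(1 / p) * (2 / D) powr (1 / p - 1) *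
        (- 2 * (p * (x powr (p - 1) - (1 - x) powr (p - 1))) / (D * D)) =
      profile p x * ((1 - x) powr (p - 1) - x powr (p - 1)) / (x powr p + (1 - x) powr p)"
      using D assms(1) unfolding D_def[symmetric] by (simp only:) (simp add: field_simps)
  qed
qed

text \<open>These are the jumps into \<open>s\<close> from states below it. Writing D for the
  denominator, \<open>x * profile p x\<close> has derivative \<open>profile p x\<close> times (D + x
  (1 - x)^(p-1) - x^p) / D, and the numerator collapses to (1 - x)^(p-1). For p < 1
  differentiability can fail at the endpoints, hence the version of the fundamental theorem that
  asks for derivatives only in the interior.\<close>

lemma has_integral_right_jumps:
  assumes p: "0 < p" and s: "0 \<le> s" "s \<le> 1"
  shows "((\<lambda>x. (1 - x) powr (p - 1) / (x powr p + (1 - x) powr p) * profile p x)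
    has_integral s * profile p s) {0..s}"
proof -
  have "((\<lambda>x. (1 - x) powr (p - 1) / (x powr p + (1 - x) powr p) * profile p x)
    has_integral s * profile p s - 0 * profile p 0) {0..s}"
  proof (rule fundamental_theorem_of_calculus_interior)
    show "continuous_on {0..s} (\<lambda>x. x * profile p x)"
      using s by (intro continuous_intros continuous_on_subset[OF profile_continuous_on[OF p]]) auto
    fix x assume x: "x \<in> {0<..<s}"
    with s have x': "x \<in> {0<..<1}" by auto
    have powr: "x powr p = x * x powr (p - 1)" "(1 - x) powr p = (1 - x) * (1 - x) powr (p - 1)"
      using x' by (simp_all add: powr_diff)
    show "((\<lambda>x. x * profile p x) has_vector_derivative
        (1 - x) powr (p - 1) / (x powr p + (1 - x) powr p) * profile p x) (at x)"
      unfolding has_real_derivative_iff_has_vector_derivative[symmetric]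
      apply (rule derivative_eq_intros profile_has_derivative[OF p x'] refl)+
      using powr_sum_pos[of x p] unfolding powr by (simp add: field_simps)
  qed (use s in auto)
  then show ?thesis by simp
qed

text \<open>The mirror image, for jumps into \<open>s\<close> from above. The factor
  \<open>x - 1\<close> is chosen to vanish at 1, so only the boundary term at \<open>s\<close>
  survives.\<close>

lemma has_integral_left_jumps:
  assumes p: "0 < p" and s: "0 \<le> s" "s \<le> 1"
  shows "((\<lambda>x. x powr (p - 1) / (x powr p + (1 - x) powr p) * profile p x)
    has_integral (1 - s) * profile p s) {s..1}"
proof -
  have "((\<lambda>x. x powr (p - 1) / (x powr p + (1 - x) powr p) * profile p x)
    has_integral (1 - 1) * profile p 1 - (s - 1) * profile p s) {s..1}"
  proof (rule fundamental_theorem_of_calculus_interior)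
    show "continuous_on {s..1} (\<lambda>x. (x - 1) * profile p x)"
      using s by (intro continuous_intros continuous_on_subset[OF profile_continuous_on[OF p]]) auto
    fix x assume x: "x \<in> {s<..<1}"
    with s have x': "x \<in> {0<..<1}" by auto
    have powr: "x powr p = x * x powr (p - 1)" "(1 - x) powr p = (1 - x) * (1 - x) powr (p - 1)"
      using x' by (simp_all add: powr_diff)
    show "((\<lambda>x. (x - 1) * profile p x) has_vector_derivative
        x powr (p - 1) / (x powr p + (1 - x) powr p) * profile p x) (at x)"
      unfolding has_real_derivative_iff_has_vector_derivative[symmetric]
      apply (rule derivative_eq_intros profile_has_derivative[OF p x'] refl)+
      using powr_sum_pos[of x p] unfolding powr by (simp add: field_simps)
  qed (use s in auto)
  then show ?thesis by (simp add: algebra_simps)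
qed

lemma kernel_measurable [measurable]:
  assumes [measurable]: "f \<in> borel_measurable M" "g \<in> borel_measurable M"
  shows "(\<lambda>z. kernel p (f z) (g z)) \<in> borel_measurable M"
  unfolding kernel_def of_bool_def by measurable

lemma kernel_nonneg: "0 \<le> kernel p s x"
  using powr_sum_pos[of x p] by (auto simp: kernel_def intro!: add_nonneg_nonneg)

lemma kernel_profile_has_integral:
  assumes p: "0 < p" and s: "s \<in> {0<..<1}"
  shows "((\<lambda>x. kernel p s x * profile p x) has_integral profile p s) {0..1}"
proof -
  have "((\<lambda>x. kernel p s x * profile p x) has_integral s * profile p s + (1 - s) * profile p s) {0..1}"
  \<comment> \<open>On each side of \<open>s\<close> only one summand of the kernel is active. At
    \<open>x = s\<close> itself both vanish, which is the single point discarded below.\<close>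
  proof (rule has_integral_combine[of 0 s 1])
    show "((\<lambda>x. kernel p s x * profile p x) has_integral s * profile p s) {0..s}"
      by (rule has_integral_spike_finite[where S = "{s}", OF _ _ has_integral_right_jumps[OF p]])
         (use s in \<open>auto simp: kernel_def\<close>)
    show "((\<lambda>x. kernel p s x * profile p x) has_integral (1 - s) * profile p s) {s..1}"
      by (rule has_integral_spike_finite[where S = "{s}", OF _ _ has_integral_left_jumps[OF p]])
         (use s in \<open>auto simp: kernel_def\<close>)
  qed (use s in auto)
  then show ?thesis by (simp add: algebra_simps)
qed

section \<open>Power mean inequalities and the bounds on the normalising constant\<close>

text \<open>Replacing both x and 1 - x by their maximum m can only enlarge the denominator, to 2
  m^p, and \<open>inv\<close> writes 1/m as the profile formula with that denominator. Unless x =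
  1/2, one of the two replacements is strict.\<close>

lemma inverse_max_le_profile:
  fixes x :: real
  assumes p: "0 < p" and x: "x \<in> {0..1}"
  shows "1 / max x (1 - x) \<le> profile p x"
    and "x \<noteq> 1 / 2 \<Longrightarrow> 1 / max x (1 - x) < profile p x"
proof -
  define m where "m = max x (1 - x)"
  have m: "0 < m" using x by (auto simp: m_def)
  have le: "x powr p \<le> m powr p" "(1 - x) powr p \<le> m powr p"
    using x p by (auto simp: m_def intro!: powr_mono2)
  have inv: "1 / m = (2 / (2 * m powr p)) powr (1 / p)"
    using m p by (simp add: powr_divide powr_powr)
  show "1 / max x (1 - x) \<le> profile p x"
    unfolding m_def[symmetric] inv profile_def
    using le m p powr_sum_pos[of x p] by (intro powr_mono2 divide_left_mono) auto
  assume "x \<noteq> 1 / 2"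
  then have "x powr p < m powr p \<or> (1 - x) powr p < m powr p"
    using x p by (auto simp: m_def max_def intro!: powr_less_mono2)
  with le show "1 / max x (1 - x) < profile p x"
    unfolding m_def[symmetric] inv profile_def
    using m p powr_sum_pos[of x p] by (intro powr_less_mono2 divide_strict_left_mono) auto
qed

text \<open>This is the inequality of arithmetic and geometric means for x^p and (1 - x)^p, whose
  square roots are \<open>a\<close> and \<open>b\<close>; it is strict because these differ.\<close>

lemma profile_less_inverse_geometric_mean:
  fixes x :: real
  assumes p: "0 < p" and x: "x \<in> {0<..<1}" "x \<noteq> 1 / 2"
  shows "profile p x < 1 / sqrt (x * (1 - x))"
proof -
  define a b where "a = x powr (p / 2)" and "b = (1 - x) powr (p / 2)"
  have ab: "0 < a" "0 < b" using x by (auto simp: a_def b_def)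
  have "a \<noteq> b"
    using x p powr_less_mono2[of "p / 2" x "1 - x"] powr_less_mono2[of "p / 2" "1 - x" x]
    by (cases "x < 1 - x") (auto simp: a_def b_def)
  then have "0 < (a - b)\<^sup>2" by simp
  then have "2 * (a * b) < a * a + b * b"
    by (simp add: power2_eq_square algebra_simps)
  moreover have "a * a = x powr p" "b * b = (1 - x) powr p"
    using x by (auto simp: a_def b_def simp flip: powr_add)
  ultimately have "2 / (x powr p + (1 - x) powr p) < 2 / (2 * (a * b))"
    using ab powr_sum_pos[of x p] by (intro divide_strict_left_mono) auto
  then have "profile p x < (2 / (2 * (a * b))) powr (1 / p)"
    unfolding profile_def using p powr_sum_pos[of x p] by (intro powr_less_mono2) auto
  also have "\<dots> = 1 / (x powr (1 / 2) * (1 - x) powr (1 / 2))"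
    using p x by (simp add: a_def b_def powr_divide powr_mult powr_powr)
  also have "\<dots> = 1 / sqrt (x * (1 - x))"
    using x by (simp add: powr_half_sqrt real_sqrt_mult)
  finally show ?thesis .
qed

lemma inverse_max_has_integral:
  "((\<lambda>x::real. 1 / max x (1 - x)) has_integral 2 * ln 2) {0..1}"
proof -
  \<comment> \<open>The boundary values stay unevaluated so that unification can read off the
    antiderivative: -ln(1 - x) on the left half, ln x on the right half. Each half contributes ln
    2.\<close>
  have "((\<lambda>x::real. 1 / max x (1 - x)) has_integral (- ln (1 - 1 / 2)) - (- ln (1 - 0))) {0..1/2}"
    by (rule fundamental_theorem_of_calculus)
       (auto intro!: derivative_eq_intros simp: max_def
             simp flip: has_real_derivative_iff_has_vector_derivative)
  moreover have "((\<lambda>x::real. 1 / max x (1 - x)) has_integral ln 1 - ln (1 / 2)) {1/2..1}"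
    by (rule fundamental_theorem_of_calculus)
       (auto intro!: derivative_eq_intros simp: max_def
             simp flip: has_real_derivative_iff_has_vector_derivative)
  ultimately have "((\<lambda>x::real. 1 / max x (1 - x)) has_integral
      (- ln (1 - 1 / 2)) - (- ln (1 - 0)) + (ln 1 - ln (1 / 2))) {0..1}"
    by (intro has_integral_combine[of 0 "1/2" 1]) auto
  then show ?thesis by (simp add: ln_div)
qed

text \<open>The antiderivative is arcsin(2x - 1), running from -pi/2 to pi/2. It is continuous on
  the closed interval although the integrand is unbounded near both ends.\<close>

lemma inverse_sqrt_has_integral:
  "((\<lambda>x::real. 1 / sqrt (x * (1 - x))) has_integral pi) {0..1}"
proof -
  have "((\<lambda>x::real. 1 / sqrt (x * (1 - x))) has_integral arcsin (2 * 1 - 1) - arcsin (2 * 0 - 1)) {0..1}"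
  proof (rule fundamental_theorem_of_calculus_interior)
    show "continuous_on {0..1} (\<lambda>x::real. arcsin (2 * x - 1))"
      by (intro continuous_intros) auto
    fix x :: real assume x: "x \<in> {0<..<1}"
    have "1 - (2 * x - 1)\<^sup>2 = 2\<^sup>2 * (x * (1 - x))"
      by (simp add: power2_eq_square algebra_simps)
    then have "sqrt (1 - (2 * x - 1)\<^sup>2) = 2 * sqrt (x * (1 - x))"
      by (simp add: real_sqrt_mult)
    with x show "((\<lambda>x. arcsin (2 * x - 1)) has_vector_derivative 1 / sqrt (x * (1 - x))) (at x)"
      unfolding has_real_derivative_iff_has_vector_derivative[symmetric]
      by (auto intro!: derivative_eq_intros simp: field_simps)
  qed simp
  then show ?thesis by (simp add: arcsin_minus)
qed

definition mass :: "real \<Rightarrow> real" where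
  "mass p = integral {0..1} (profile p)"

lemma profile_has_integral: "0 < p \<Longrightarrow> (profile p has_integral mass p) {0..1}"
  unfolding mass_def
  by (intro integrable_integral integrable_continuous_real profile_continuous_on)

lemma mass_bounds:
  assumes p: "0 < p"
  shows "2 * ln 2 < mass p" "mass p < pi"
proof -
  \<comment> \<open>All three functions take the value 2 at x = 1/2, so that point is exempted from
    the strict comparison, here and for the upper bound.\<close>
  have "0 < mass p - 2 * ln 2"
    by (rule has_integral_pos_of_pos[OF
          has_integral_diff[OF profile_has_integral inverse_max_has_integral], where S = "{1/2}"])
       (use p in \<open>auto intro: inverse_max_le_profile(2)\<close>)
  then show "2 * ln 2 < mass p" by simp
  have "0 < pi - mass p"
    by (rule has_integral_pos_of_pos[OF
          has_integral_diff[OF inverse_sqrt_has_integral profile_has_integral], where S = "{1/2}"])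
       (use p in \<open>auto intro: profile_less_inverse_geometric_mean\<close>)
  then show "mass p < pi" by simp
qed

lemma mass_pos: "0 < p \<Longrightarrow> 0 < mass p"
  using mass_bounds(1)[of p] ln_gt_zero[of "2::real"] by linarith

section \<open>Normalisation and the stationarity equation\<close>

text \<open>Carries gauge integrals over to Lebesgue integrals: nonnegativity makes the convergence
  absolute, and dropping the two endpoints changes nothing.\<close>

lemma has_bochner_integral_unit_interval:
  fixes f :: "real \<Rightarrow> real"
  assumes [measurable]: "f \<in> borel_measurable borel" and nonneg: "\<And>x. 0 \<le> f x"
    and I: "(f has_integral I) {0..1}"
  shows "has_bochner_integral lborel (\<lambda>x. indicator {0<..<1} x * f x) I"
proof (rule has_bochner_integral_nn_integral)
  have "((\<lambda>x. indicator {0<..<1} x * f x) has_integral I) {0..1}"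
    by (rule has_integral_spike_finite[where S = "{0, 1}", OF _ _ I]) auto
  then have "((\<lambda>x. if x \<in> {0..1} then indicator {0<..<1} x * f x else 0) has_integral I) UNIV"
    by (simp only: has_integral_restrict_UNIV)
  moreover have "(\<lambda>x. if x \<in> {0..1} then indicator {0<..<1} x * f x else 0) =
      (\<lambda>x. indicator {0<..<1} x * f x)"
    by (auto simp: indicator_def fun_eq_iff)
  ultimately have "((\<lambda>x. indicator {0<..<1} x * f x) has_integral I) UNIV"
    by simp
  then show "(\<integral>\<^sup>+x. ennreal (indicator {0<..<1} x * f x) \<partial>lborel) = ennreal I"
    using nonneg by (intro nn_integral_has_integral_lborel) auto
  show "0 \<le> I"
    using has_integral_nonneg[OF I] nonneg by simp
qed (use nonneg in auto)

lemma rho_measurable [measurable]: "rho p Z \<in> borel_measurable borel"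
  unfolding rho_eq_profile[abs_def] by measurable

lemma rho_nonneg: "0 \<le> Z \<Longrightarrow> 0 \<le> rho p Z x"
  by (simp add: rho_eq_profile profile_nonneg)

lemma prob_space_rho:
  assumes p: "0 < p"
  shows "prob_space (density lborel (rho p (mass p)))"
proof
  have "has_bochner_integral lborel (\<lambda>x. 1 / mass p * (indicator {0<..<1} x * profile p x))
      (1 / mass p * mass p)"
    by (intro has_bochner_integral_mult_right has_bochner_integral_unit_interval
        profile_has_integral p profile_measurable profile_nonneg)
  then have "has_bochner_integral lborel (rho p (mass p)) 1"
    using mass_pos[OF p] by (simp add: rho_eq_profile[abs_def] ac_simps)
  then have "(\<integral>\<^sup>+x. rho p (mass p) x \<partial>lborel) = 1"
    using mass_pos[OF p] rho_nonneg[of "mass p" p]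
    by (subst nn_integral_eq_integral) (auto simp: has_bochner_integral_iff)
  then show "emeasure (density lborel (rho p (mass p))) (space (density lborel (rho p (mass p)))) = 1"
    by (simp add: emeasure_density)
qed

text \<open>For \<open>s\<close> outside the unit interval the kernel vanishes at every state
  \<open>x\<close> inside it, and so does \<open>rho\<close> at \<open>s\<close>. The equation
  therefore holds for every \<open>s\<close>, not just almost every one.\<close>

lemma kernel_rho_has_bochner_integral:
  assumes p: "0 < p"
  shows "has_bochner_integral lborel
    (\<lambda>x. indicator {0<..<1} x * (kernel p s x * rho p (mass p) x)) (rho p (mass p) s)"
proof (cases "s \<in> {0<..<1}")
  case True
  have "has_bochner_integral lborel
      (\<lambda>x. 1 / mass p * (indicator {0<..<1} x * (kernel p s x * profile p x))) (1 / mass p * profile p s)"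
    using kernel_nonneg[of p s] profile_nonneg[of p]
    by (intro has_bochner_integral_mult_right has_bochner_integral_unit_interval
        kernel_profile_has_integral p True) auto
  moreover have "(\<lambda>x. 1 / mass p * (indicator {0<..<1} x * (kernel p s x * profile p x))) =
      (\<lambda>x. indicator {0<..<1} x * (kernel p s x * rho p (mass p) x))"
    by (simp add: rho_eq_profile indicator_def fun_eq_iff)
  moreover have "1 / mass p * profile p s = rho p (mass p) s"
    using True by (simp add: rho_eq_profile)
  ultimately show ?thesis
    by (simp only:)
next
  case False
  then have "(\<lambda>x. indicator {0<..<1} x * (kernel p s x * rho p (mass p) x)) = (\<lambda>x. 0)"
    by (auto simp: kernel_def indicator_def)
  with False show ?thesis by (simp add: rho_eq_profile has_bochner_integral_zero)
qed

lemma stationary_density_rho: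
  assumes p: "0 < p"
  shows "stationary_density p (rho p (mass p))"
  unfolding stationary_density_def
proof (intro conjI allI impI AE_I2)
  fix s
  show "set_integrable lborel {0<..<1} (\<lambda>x. kernel p s x * rho p (mass p) x)"
    "rho p (mass p) s = (LINT x:{0<..<1}|lborel. kernel p s x * rho p (mass p) x)"
    using kernel_rho_has_bochner_integral[OF p, of s]
    by (simp_all add: set_integrable_def set_lebesgue_integral_def has_bochner_integral_iff)
qed (use mass_pos[OF p] prob_space_rho[OF p] in \<open>auto simp: rho_nonneg rho_eq_profile profile_nonneg\<close>)

section \<open>The one-step law and its density\<close>

text \<open>The law is a mixture of two uniform laws, and both intervals have positive length
  because x lies strictly inside the unit interval. Their masses within a Borel set are finite, so
  the comparison of the two measures reduces to real arithmetic.\<close>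

lemma
  assumes x: "x \<in> {0<..<1}"
  shows sets_step [simp]: "sets (step p x) = sets borel"
    and prob_space_step: "prob_space (step p x)"
    and step_eq_density: "step p x = density lborel (\<lambda>s. kernel p s x)"
proof -
  define q where "q = x powr p / (x powr p + (1 - x) powr p)"
  have D: "0 < x powr p + (1 - x) powr p" by (rule powr_sum_pos)
  have q: "0 \<le> q" "q \<le> 1" using D by (auto simp: q_def)
  have q': "1 - q = (1 - x) powr p / (x powr p + (1 - x) powr p)"
    using D by (simp add: q_def field_simps)
  define U where "U left = uniform_measure lborel (if left then {0<..<x} else {x<..<1})" for left
  have U: "prob_space (U left)" for left
    using x by (auto simp: U_def intro!: prob_space_uniform_measure)
  have setsU: "sets (U left) = sets borel" for left
    by (simp add: U_def)
  have U_meas [measurable]: "U \<in> measure_pmf (bernoulli_pmf q) \<rightarrow>\<^sub>M subprob_algebra borel"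
  proof -
    have "U left \<in> space (subprob_algebra borel)" for left
      unfolding space_subprob_algebra using prob_space_imp_subprob_space[OF U] setsU by simp
    then show ?thesis by simp
  qed
  have step: "step p x = measure_pmf (bernoulli_pmf q) \<bind> U"
    by (simp add: step_def q_def U_def[abs_def])
  show sets: "sets (step p x) = sets borel"
    unfolding step by (rule sets_bind) (auto simp: U_def)
  show "prob_space (step p x)"
    unfolding step by (rule measure_pmf.prob_space_bind[OF _ U_meas]) (simp add: U)
  show "step p x = density lborel (\<lambda>s. kernel p s x)"
  proof (rule measure_eqI)
    fix B assume "B \<in> sets (step p x)"
    then have [measurable]: "B \<in> sets borel" by (simp add: sets)
    define a b where "a = x powr (p - 1) / (x powr p + (1 - x) powr p)"
      and "b = (1 - x) powr (p - 1) / (x powr p + (1 - x) powr p)"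
    have ab: "0 \<le> a" "0 \<le> b" using D by (auto simp: a_def b_def)
    define l r where "l = measure lborel ({0<..<x} \<inter> B)" and "r = measure lborel ({x<..<1} \<inter> B)"
    have fin: "emeasure lborel ({0<..<x} \<inter> B) < \<infinity>" "emeasure lborel ({x<..<1} \<inter> B) < \<infinity>"
      using x emeasure_mono[of "{0<..<x} \<inter> B" "{0<..<1}" lborel] emeasure_mono[of "{x<..<1} \<inter> B" "{0<..<1}" lborel]
      by (force intro: le_less_trans[of _ "1 :: ennreal"])+
    then have l: "emeasure lborel ({0<..<x} \<inter> B) = ennreal l" "0 \<le> l"
      and r: "emeasure lborel ({x<..<1} \<inter> B) = ennreal r" "0 \<le> r"
      by (auto simp: l_def r_def emeasure_eq_ennreal_measure)
    have "emeasure (step p x) B = emeasure (U True) B * q + emeasure (U False) B * (1 - q)"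
      unfolding step by (subst emeasure_bind[OF _ U_meas]) (simp_all add: q)
    also have "\<dots> = ennreal (l / x * q + r / (1 - x) * (1 - q))"
      using x q l r by (simp add: U_def divide_ennreal flip: ennreal_mult ennreal_plus)
    \<comment> \<open>Dividing the coin probability by the length of the interval lowers the
      exponent from p to p - 1.\<close>
    also have "l / x * q = a * l"
      using x by (simp add: q_def a_def powr_diff)
    also have "r / (1 - x) * (1 - q) = b * r"
      using x by (simp add: q' b_def powr_diff)
    also have "ennreal (a * l + b * r) =
      (\<integral>\<^sup>+s. ennreal a * indicator ({0<..<x} \<inter> B) s + ennreal b * indicator ({x<..<1} \<inter> B) s \<partial>lborel)"
      using l r ab by (simp add: nn_integral_add nn_integral_cmult ennreal_plus ennreal_mult)
    also have "\<dots> = (\<integral>\<^sup>+s. ennreal (kernel p s x) * indicator B s \<partial>lborel)"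
      using x by (intro nn_integral_cong) (auto simp: kernel_def a_def b_def indicator_def)
    also have "\<dots> = emeasure (density lborel (\<lambda>s. kernel p s x)) B"
      by (subst emeasure_density) auto
    finally show "emeasure (step p x) B = emeasure (density lborel (\<lambda>s. kernel p s x)) B" .
  qed (simp add: sets)
qed

section \<open>Minorisation and the oscillation of averaged test functions\<close>

text \<open>A state above \<open>s\<close> is larger than 1/3, and a state below \<open>s\<close>
  has 1 - x larger than 1/3, so the active numerator is y^(p-1) with y between 1/3 and 1, while the
  denominator is at most 2. At \<open>s = x\<close> the kernel is 0, so that point is
  excluded.\<close>

lemma kernel_minorization:
  assumes p: "0 < p" and x: "x \<in> {0<..<1}" and s: "s \<in> {1/3<..<2/3}" "s \<noteq> x"
  shows "(1 / 3) powr p / 2 \<le> kernel p s x"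
proof -
  have D: "x powr p + (1 - x) powr p \<le> 2"
    using x p powr_mono2[of p x 1] powr_mono2[of p "1 - x" 1] by simp
  have *: "(1 / 3) powr p / 2 \<le> y powr (p - 1) / (x powr p + (1 - x) powr p)"
    if y: "1 / 3 \<le> y" "y \<le> 1" for y
  proof (rule frac_le)
    \<comment> \<open>Passing through the exponent p avoids a case distinction on the sign of p -
      1.\<close>
    have "(1 / 3) powr p \<le> y powr p" using y p by (intro powr_mono2) auto
    also have "\<dots> \<le> y powr (p - 1)" using y by (intro powr_mono') auto
    finally show "(1 / 3) powr p \<le> y powr (p - 1)" .
  qed (use D powr_sum_pos in auto)
  show ?thesis
    using s x *[of x] *[of "1 - x"] by (cases "s < x") (auto simp: kernel_def)
qed

text \<open>The expectation of \<open>h\<close> after one step from \<open>x\<close>, as an integral over the kernel so that it is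
  measurable in \<open>x\<close> on the whole line.\<close>

definition averaged :: "real \<Rightarrow> (real \<Rightarrow> real) \<Rightarrow> real \<Rightarrow> real" where
  "averaged p h x = (\<integral>s. kernel p s x * h s \<partial>lborel)"

lemma averaged_measurable [measurable]:
  assumes [measurable]: "h \<in> borel_measurable borel"
  shows "averaged p h \<in> borel_measurable borel"
proof -
  have "averaged p h = (\<lambda>x. \<integral>s. kernel p s x * h s \<partial>lborel)"
    by (simp add: averaged_def[abs_def])
  then show ?thesis by simp
qed

lemma averaged_eq_integral_step:
  assumes "x \<in> {0<..<1}" and [measurable]: "h \<in> borel_measurable borel"
  shows "averaged p h x = (\<integral>s. h s \<partial>step p x)"
  using assms(1) by (simp add: averaged_def step_eq_density integral_density kernel_nonneg)

lemma averaged_ge: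
  assumes p: "0 < p" and x: "x \<in> {0<..<1}"
    and [measurable]: "h \<in> borel_measurable borel" and h: "\<And>s. 0 \<le> h s" "\<And>s. h s \<le> 1"
  shows "(1 / 3) powr p / 2 * (LINT s:{1/3<..<2/3}|lborel. h s) \<le> averaged p h x"
proof -
  interpret step: prob_space "step p x" by (rule prob_space_step[OF x])
  have "integrable (step p x) h"
    using h x by (intro step.integrable_const_bound[of _ 1]) (auto simp: measurable_cong_sets[OF sets_step[OF x] refl])
  then have int: "integrable lborel (\<lambda>s. kernel p s x * h s)"
    using x by (simp add: step_eq_density integrable_density kernel_nonneg)
  have "(1 / 3) powr p / 2 * (LINT s:{1/3<..<2/3}|lborel. h s) =
      (\<integral>s. (1 / 3) powr p / 2 * (indicator {1/3<..<2/3} s * h s) \<partial>lborel)"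
    by (simp add: set_lebesgue_integral_def)
  also have "\<dots> \<le> averaged p h x"
    unfolding averaged_def
  proof (rule integral_mono_AE[OF _ int])
    have "set_integrable lborel {1/3<..<2/3} h"
      unfolding set_integrable_def real_scaleR_def
      by (rule Bochner_Integration.integrable_bound[of _ "indicator {1/3<..<2/3} :: real \<Rightarrow> real"])
         (use h in \<open>auto simp: indicator_def\<close>)
    then show "integrable lborel (\<lambda>s. (1 / 3) powr p / 2 * (indicator {1/3<..<2/3} s * h s))"
      by (simp add: set_integrable_def)
    have "AE s in lborel. s \<noteq> x" by (rule AE_lborel_singleton)
    then show "AE s in lborel. (1 / 3) powr p / 2 * (indicator {1/3<..<2/3} s * h s) \<le> kernel p s x * h s"
    proof eventually_elim
      case (elim s)
      show ?case
        using mult_right_mono[OF kernel_minorization[OF p x _ elim] h(1)[of s]]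
          h(1)[of s] kernel_nonneg[of p s x]
        by (cases "s \<in> {1/3<..<2/3}") auto
    qed
  qed
  finally show ?thesis .
qed

text \<open>This is \<open>averaged_ge\<close> applied to \<open>1 - h\<close>. The minorising
  measure has density \<open>(1 / 3) powr p / 2\<close> on an interval of length 1/3, hence total
  mass \<open>(1 / 3) powr p / 6\<close>. Both bounds share the term in \<open>h\<close>, so they
  confine the average to an interval of length one minus this mass.\<close>

lemma averaged_le:
  assumes p: "0 < p" and x: "x \<in> {0<..<1}"
    and [measurable]: "h \<in> borel_measurable borel" and h: "\<And>s. 0 \<le> h s" "\<And>s. h s \<le> 1"
  shows "averaged p h x \<le>
    (1 / 3) powr p / 2 * (LINT s:{1/3<..<2/3}|lborel. h s) + (1 - (1 / 3) powr p / 6)"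
proof -
  interpret step: prob_space "step p x" by (rule prob_space_step[OF x])
  have "integrable (step p x) h"
    using h x by (intro step.integrable_const_bound[of _ 1]) (auto simp: measurable_cong_sets[OF sets_step[OF x] refl])
  then have compl: "averaged p (\<lambda>s. 1 - h s) x = 1 - averaged p h x"
    using x by (simp add: averaged_eq_integral_step step.prob_space)
  have "set_integrable lborel {1/3<..<2/3} h"
      unfolding set_integrable_def real_scaleR_def
      by (rule Bochner_Integration.integrable_bound[of _ "indicator {1/3<..<2/3} :: real \<Rightarrow> real"])
         (use h in \<open>auto simp: indicator_def\<close>)
  then have eq: "(LINT s:{1/3<..<2/3}|lborel. 1 - h s) = 1 / 3 - (LINT s:{1/3<..<2/3}|lborel. h s)"
    by (subst set_integral_diff) (auto simp: set_integrable_def set_lebesgue_integral_def)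
  have "(1 / 3) powr p / 2 * (LINT s:{1/3<..<2/3}|lborel. 1 - h s) \<le> averaged p (\<lambda>s. 1 - h s) x"
    using h by (intro averaged_ge[OF p x]) auto
  then show ?thesis unfolding eq compl by (simp add: algebra_simps)
qed

section \<open>Evolution of laws and its contraction\<close>

definition on_unit_interval :: "real measure \<Rightarrow> bool" where
  "on_unit_interval \<mu> \<longleftrightarrow> prob_space \<mu> \<and> sets \<mu> = sets borel \<and> (AE x in \<mu>. x \<in> {0<..<1})"

text \<open>Stated as a relation so that it covers both consecutive marginals of a chain and a
  stationary law, which evolves to itself. One contraction argument then serves uniqueness and
  convergence.\<close>

definition evolves :: "real \<Rightarrow> real measure \<Rightarrow> real measure \<Rightarrow> bool" where
  "evolves p \<mu> \<nu> \<longleftrightarrow> on_unit_interval \<mu> \<and> on_unit_interval \<nu> \<and>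
    (\<forall>B\<in>sets borel. emeasure \<nu> B = (\<integral>\<^sup>+x. emeasure (step p x) B \<partial>\<mu>))"

text \<open>The duality between moving the law forward and averaging the test function, obtained
  from Tonelli's theorem.\<close>

lemma evolves_integral:
  assumes ev: "evolves p \<mu> \<nu>"
    and [measurable]: "h \<in> borel_measurable borel" and h: "\<And>s. 0 \<le> h s" "\<And>s. h s \<le> 1"
  shows "(\<integral>s. h s \<partial>\<nu>) = (\<integral>x. averaged p h x \<partial>\<mu>)"
proof -
  interpret \<mu>: prob_space \<mu> using ev by (simp add: evolves_def on_unit_interval_def)
  interpret \<nu>: prob_space \<nu> using ev by (simp add: evolves_def on_unit_interval_def)
  interpret P: pair_sigma_finite lborel \<mu> ..
  have sets_\<mu> [measurable_cong]: "sets \<mu> = sets borel"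
    and sets_\<nu> [measurable_cong]: "sets \<nu> = sets borel"
    and AE: "AE x in \<mu>. x \<in> {0<..<1}"
    using ev by (simp_all only: evolves_def on_unit_interval_def)
  have em: "emeasure \<nu> B = (\<integral>\<^sup>+x. emeasure (step p x) B \<partial>\<mu>)" if "B \<in> sets borel" for B
    using ev that by (simp add: evolves_def)
  have swap: "(\<integral>\<^sup>+x. (\<integral>\<^sup>+s. ennreal (kernel p s x) * f s \<partial>lborel) \<partial>\<mu>) =
      (\<integral>\<^sup>+s. (\<integral>\<^sup>+x. ennreal (kernel p s x) \<partial>\<mu>) * f s \<partial>lborel)"
    if [measurable]: "f \<in> borel_measurable borel" for f
  proof -
    have "(\<integral>\<^sup>+x. (\<integral>\<^sup>+s. ennreal (kernel p s x) * f s \<partial>lborel) \<partial>\<mu>) =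
        (\<integral>\<^sup>+s. (\<integral>\<^sup>+x. ennreal (kernel p s x) * f s \<partial>\<mu>) \<partial>lborel)"
      by (rule P.Fubini') measurable
    also have "\<dots> = (\<integral>\<^sup>+s. (\<integral>\<^sup>+x. ennreal (kernel p s x) \<partial>\<mu>) * f s \<partial>lborel)"
      by (intro nn_integral_cong nn_integral_multc) measurable
    finally show ?thesis .
  qed
  \<comment> \<open>One step produces a Lebesgue density even if the initial law has none.\<close>
  have \<nu>: "\<nu> = density lborel (\<lambda>s. \<integral>\<^sup>+x. ennreal (kernel p s x) \<partial>\<mu>)"
  proof (rule measure_eqI)
    fix B assume "B \<in> sets \<nu>"
    then have [measurable]: "B \<in> sets borel" by (simp add: sets_\<nu>)
    have "emeasure \<nu> B = (\<integral>\<^sup>+x. (\<integral>\<^sup>+s. ennreal (kernel p s x) * indicator B s \<partial>lborel) \<partial>\<mu>)"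
      unfolding em[OF \<open>B \<in> sets borel\<close>]
      by (rule nn_integral_cong_AE) (use AE in \<open>eventually_elim, simp add: step_eq_density emeasure_density\<close>)
    also have "\<dots> = emeasure (density lborel (\<lambda>s. \<integral>\<^sup>+x. ennreal (kernel p s x) \<partial>\<mu>)) B"
      by (subst swap) (auto simp: emeasure_density)
    finally show "emeasure \<nu> B = \<dots>" .
  qed (simp add: sets_\<nu>)
  \<comment> \<open>\<open>averaged\<close> is a Bochner integral, so its agreement with the
    extended nonnegative integral and its bounds are established where the kernel is a probability
    density, that is, for x in the unit interval.\<close>
  have "AE x in \<mu>. 0 \<le> averaged p h x \<and> averaged p h x \<le> 1 \<and>
      (\<integral>\<^sup>+s. ennreal (kernel p s x) * ennreal (h s) \<partial>lborel) = ennreal (averaged p h x)"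
    using AE
  proof eventually_elim
    case (elim x)
    interpret step: prob_space "step p x" by (rule prob_space_step[OF elim])
    have int: "integrable (step p x) h"
      using h elim by (intro step.integrable_const_bound[of _ 1])
        (auto simp: measurable_cong_sets[OF sets_step[OF elim] refl])
    have "(\<integral>\<^sup>+s. ennreal (kernel p s x) * ennreal (h s) \<partial>lborel) = (\<integral>\<^sup>+s. ennreal (h s) \<partial>step p x)"
      using elim by (simp add: step_eq_density nn_integral_density)
    also have "\<dots> = ennreal (averaged p h x)"
      using int h elim by (simp add: averaged_eq_integral_step nn_integral_eq_integral)
    finally show ?case
      using int h elim
      by (auto simp: averaged_eq_integral_step intro!: integral_nonneg step.integral_le_const)
  qed
  then have nonneg: "AE x in \<mu>. 0 \<le> averaged p h x"
    and le_1: "AE x in \<mu>. norm (averaged p h x) \<le> 1"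
    and nn: "AE x in \<mu>. (\<integral>\<^sup>+s. ennreal (kernel p s x) * ennreal (h s) \<partial>lborel) = ennreal (averaged p h x)"
    by (eventually_elim, simp)+
  have "ennreal (\<integral>s. h s \<partial>\<nu>) = (\<integral>\<^sup>+s. ennreal (h s) \<partial>\<nu>)"
    using h by (intro nn_integral_eq_integral[symmetric] \<nu>.integrable_const_bound[of _ 1]) auto
  also have "\<dots> = (\<integral>\<^sup>+x. (\<integral>\<^sup>+s. ennreal (kernel p s x) * ennreal (h s) \<partial>lborel) \<partial>\<mu>)"
    unfolding \<nu> by (subst swap) (auto simp: nn_integral_density)
  also have "\<dots> = (\<integral>\<^sup>+x. ennreal (averaged p h x) \<partial>\<mu>)"
    by (rule nn_integral_cong_AE[OF nn])
  also have "\<dots> = ennreal (\<integral>x. averaged p h x \<partial>\<mu>)"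
    by (intro nn_integral_eq_integral \<mu>.integrable_const_bound[of _ 1])
       (use nonneg le_1 in auto)
  finally show ?thesis
    using h nonneg by (simp add: integral_nonneg_AE)
qed

text \<open>One step maps a test function with values in \<open>[0, 1]\<close> to one whose values on \<open>(0, 1)\<close> lie in an
  interval of length \<open>1 - (1 / 3) powr p / 6\<close>; rescaling it to \<open>[0, 1]\<close> gains this factor per step.\<close>

lemma evolves_contraction:
  assumes p: "0 < p" and ev: "\<And>t. evolves p (\<mu> t) (\<mu> (Suc t))" "\<And>t. evolves p (\<nu> t) (\<nu> (Suc t))"
    and h: "h \<in> borel_measurable borel" "\<And>s. 0 \<le> h s" "\<And>s. h s \<le> 1"
  shows "\<bar>(\<integral>s. h s \<partial>\<mu> t) - (\<integral>s. h s \<partial>\<nu> t)\<bar> \<le> (1 - (1 / 3) powr p / 6) ^ t"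
  using h
proof (induction t arbitrary: h)
  case 0
  have "0 \<le> (\<integral>s. h s \<partial>M) \<and> (\<integral>s. h s \<partial>M) \<le> 1" if "on_unit_interval M" for M
  proof -
    interpret prob_space M using that by (simp add: on_unit_interval_def)
    have [measurable_cong]: "sets M = sets borel" using that by (simp add: on_unit_interval_def)
    note [measurable] = "0.prems"(1)
    have "integrable M h"
      using "0.prems" by (intro integrable_const_bound[of _ 1]) auto
    then show ?thesis
      using "0.prems" by (auto intro!: integral_nonneg integral_le_const)
  qed
  then have "0 \<le> (\<integral>s. h s \<partial>\<mu> 0) \<and> (\<integral>s. h s \<partial>\<mu> 0) \<le> 1" "0 \<le> (\<integral>s. h s \<partial>\<nu> 0) \<and> (\<integral>s. h s \<partial>\<nu> 0) \<le> 1"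
    using ev[of 0] by (auto simp: evolves_def)
  then show ?case by auto
next
  case (Suc t)
  note [measurable] = Suc.prems(1)
  define a where "a = (1 / 3) powr p / 2 * (LINT s:{1/3<..<2/3}|lborel. h s)"
  define r where "r = 1 - (1 / 3) powr p / 6"
  have r: "0 < r"
    using p powr_mono2[of p "1 / 3" 1] by (simp add: r_def)
  have range: "a \<le> averaged p h x" "averaged p h x \<le> a + r" if "x \<in> {0<..<1}" for x
    using averaged_ge[OF p that Suc.prems] averaged_le[OF p that Suc.prems] by (auto simp: a_def r_def)
  \<comment> \<open>The value 0 off the unit interval keeps \<open>g\<close> within [0, 1]
    everywhere, as the induction hypothesis demands; the laws involved give no mass there.\<close>
  define g where "g x = (if x \<in> {0<..<1} then (averaged p h x - a) / r else 0)" for x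
  have g: "g \<in> borel_measurable borel" "0 \<le> g x" "g x \<le> 1" for x
  proof -
    show "g \<in> borel_measurable borel" unfolding g_def by measurable
    show "0 \<le> g x" "g x \<le> 1" using range[of x] r by (auto simp: g_def)
  qed
  have eq: "(\<integral>s. h s \<partial>M') = a + r * (\<integral>s. g s \<partial>M)" if ev: "evolves p M M'" for M M'
  proof -
    interpret prob_space M using ev by (simp add: evolves_def on_unit_interval_def)
    have [measurable_cong]: "sets M = sets borel" and AE: "AE x in M. x \<in> {0<..<1}"
      using ev by (auto simp: evolves_def on_unit_interval_def)
    note [measurable] = g(1)
    have "integrable M g"
      using g by (intro integrable_const_bound[of _ 1]) auto
    then have "a + r * (\<integral>s. g s \<partial>M) = (\<integral>s. a + r * g s \<partial>M)"
      by (simp add: prob_space)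
    also have "\<dots> = (\<integral>x. averaged p h x \<partial>M)"
    proof (rule integral_cong_AE)
      show "AE x in M. a + r * g x = averaged p h x"
        using AE by eventually_elim (use r in \<open>simp add: g_def\<close>)
    qed measurable
    also have "\<dots> = (\<integral>s. h s \<partial>M')"
      using evolves_integral[OF ev] Suc.prems by simp
    finally show ?thesis by simp
  qed
  \<comment> \<open>The offset \<open>a\<close> depends only on \<open>h\<close>, so it cancels
    between the two laws.\<close>
  have "\<bar>(\<integral>s. h s \<partial>\<mu> (Suc t)) - (\<integral>s. h s \<partial>\<nu> (Suc t))\<bar> = r * \<bar>(\<integral>s. g s \<partial>\<mu> t) - (\<integral>s. g s \<partial>\<nu> t)\<bar>"
    using r by (simp add: eq[OF ev(1)] eq[OF ev(2)] abs_mult flip: right_diff_distrib)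
  also have "\<dots> \<le> r * r ^ t"
    using Suc.IH[OF g] r by (intro mult_left_mono) (auto simp: r_def)
  finally show ?case by (simp add: r_def)
qed

lemma evolves_measure_bound:
  assumes p: "0 < p" and ev: "\<And>t. evolves p (\<mu> t) (\<mu> (Suc t))" "\<And>t. evolves p (\<nu> t) (\<nu> (Suc t))"
    and B: "B \<in> sets borel"
  shows "\<bar>measure (\<mu> t) B - measure (\<nu> t) B\<bar> \<le> (1 - (1 / 3) powr p / 6) ^ t"
proof -
  have "sets (\<mu> t) = sets borel" "sets (\<nu> t) = sets borel"
    using ev[of t] by (auto simp: evolves_def on_unit_interval_def)
  then have "space (\<mu> t) = UNIV" "space (\<nu> t) = UNIV"
    by (metis sets_eq_imp_space_eq space_borel)+
  then show ?thesis
    using evolves_contraction[where \<mu> = \<mu> and \<nu> = \<nu> and h = "indicator B" and t = t, OF p ev] B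
    by simp
qed

lemma contraction_rate_tendsto:
  "0 < p \<Longrightarrow> (\<lambda>t. (1 - (1 / 3 :: real) powr p / 6) ^ t) \<longlonglongrightarrow> 0"
  using powr_mono2[of p "1 / 3" 1] by (intro LIMSEQ_realpow_zero) auto

lemma stationary_distribution_iff_evolves:
  "stationary_distribution p \<mu> \<longleftrightarrow> evolves p \<mu> \<mu>"
proof -
  have "emeasure \<mu> {0<..<1} = 1 \<longleftrightarrow> (AE x in \<mu>. x \<in> {0<..<1})"
    if "prob_space \<mu>" "sets \<mu> = sets borel"
  proof -
    interpret prob_space \<mu> by fact
    have "{0<..<1} \<in> sets \<mu>" using that by simp
    then show ?thesis by (metis AE_in_set_eq_1 emeasure_eq_measure ennreal_eq_1)
  qed
  then show ?thesis
    by (auto simp: stationary_distribution_def evolves_def on_unit_interval_def)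
qed

text \<open>Integrating the stationarity equation \<open>kr\<close> over a set and exchanging the
  integrals turns the equation for densities into one for measures.\<close>

lemma rho_evolves:
  assumes p: "0 < p"
  shows "evolves p (density lborel (rho p (mass p))) (density lborel (rho p (mass p)))"
    (is "evolves p ?\<rho> ?\<rho>")
proof -
  have AE: "AE x in ?\<rho>. x \<in> {0<..<1}"
    by (subst AE_density) (auto simp: rho_eq_profile indicator_def)
  have nonneg: "0 \<le> rho p (mass p) x" for x
    using mass_pos[OF p] by (simp add: rho_nonneg)
  have kr: "(\<integral>\<^sup>+x. ennreal (rho p (mass p) x) * ennreal (kernel p s x) \<partial>lborel) = rho p (mass p) s" for s
  proof -
    have "(\<integral>\<^sup>+x. ennreal (rho p (mass p) x) * ennreal (kernel p s x) \<partial>lborel) =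
        (\<integral>\<^sup>+x. ennreal (indicator {0<..<1} x * (kernel p s x * rho p (mass p) x)) \<partial>lborel)"
    proof (rule nn_integral_cong)
      fix x
      show "ennreal (rho p (mass p) x) * ennreal (kernel p s x) =
          ennreal (indicator {0<..<1} x * (kernel p s x * rho p (mass p) x))"
      proof (cases "x \<in> {0<..<1}")
        case True
        then show ?thesis
          by (simp add: nonneg kernel_nonneg mult.commute flip: ennreal_mult)
      qed (simp add: rho_eq_profile)
    qed
    also have "\<dots> = rho p (mass p) s"
      using kernel_rho_has_bochner_integral[OF p, of s] nonneg kernel_nonneg
      by (subst nn_integral_eq_integral) (auto simp: has_bochner_integral_iff)
    finally show ?thesis .
  qed
  have "emeasure ?\<rho> B = (\<integral>\<^sup>+x. emeasure (step p x) B \<partial>?\<rho>)" if [measurable]: "B \<in> sets borel" for B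
  proof -
    have "(\<integral>\<^sup>+x. emeasure (step p x) B \<partial>?\<rho>) =
        (\<integral>\<^sup>+x. (\<integral>\<^sup>+s. ennreal (kernel p s x) * indicator B s \<partial>lborel) \<partial>?\<rho>)"
      by (rule nn_integral_cong_AE) (use AE in \<open>eventually_elim, simp add: step_eq_density emeasure_density\<close>)
    also have "\<dots> = (\<integral>\<^sup>+x. (\<integral>\<^sup>+s. ennreal (rho p (mass p) x) * ennreal (kernel p s x) * indicator B s \<partial>lborel) \<partial>lborel)"
      by (simp add: nn_integral_density nn_integral_cmult mult.assoc)
    also have "\<dots> = (\<integral>\<^sup>+s. (\<integral>\<^sup>+x. ennreal (rho p (mass p) x) * ennreal (kernel p s x) * indicator B s \<partial>lborel) \<partial>lborel)"
      by (rule lborel_pair.Fubini') measurable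
    also have "\<dots> = (\<integral>\<^sup>+s. ennreal (rho p (mass p) s) * indicator B s \<partial>lborel)"
      by (simp add: nn_integral_multc kr)
    finally show ?thesis by (simp add: emeasure_density)
  qed
  with AE prob_space_rho[OF p] show ?thesis
    by (simp add: evolves_def on_unit_interval_def)
qed

section \<open>Marginal laws of the chain and convergence\<close>

lemma subalgebra_history:
  assumes [measurable]: "\<And>t. X t \<in> borel_measurable M"
  shows "subalgebra M (history M X t)"
  unfolding subalgebra_def history_def
  by (intro conjI sets_image_in_sets measurable_restrict) simp_all

text \<open>Conditional expectation preserves the mean, so taking expectations in the Markov
  property leaves an equation between the laws of two consecutive states.\<close>

lemma markov_chain_evolves:
  assumes "markov_chain p M X"
  shows "evolves p (distr M borel (X t)) (distr M borel (X (Suc t)))"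
proof -
  interpret prob_space M using assms by (simp add: markov_chain_def)
  have X [measurable]: "X t \<in> borel_measurable M" for t
    using assms by (simp add: markov_chain_def)
  have range: "X t \<omega> \<in> {0<..<1}" if "\<omega> \<in> space M" for t \<omega>
    using assms that by (simp add: markov_chain_def)
  have cond: "AE \<omega> in M. real_cond_exp M (history M X t) (\<lambda>\<omega>. indicator B (X (Suc t) \<omega>)) \<omega> =
      measure (step p (X t \<omega>)) B" if "B \<in> sets borel" for B
    using assms that by (simp add: markov_chain_def)
  interpret H: finite_measure_subalgebra M "history M X t"
    by unfold_locales (rule subalgebra_history[OF X])
  have on: "on_unit_interval (distr M borel (X t))" for t
    using range by (auto simp: on_unit_interval_def prob_space_distr AE_distr_iff)
  have "emeasure (distr M borel (X (Suc t))) B = (\<integral>\<^sup>+x. emeasure (step p x) B \<partial>distr M borel (X t))"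
    if [measurable]: "B \<in> sets borel" for B
  proof -
    \<comment> \<open>A stand-in for the one-step probability of \<open>B\<close> that is measurable
      on the whole line and agrees with it on the unit interval, where the chain lives.\<close>
    define k where "k x = (\<integral>\<^sup>+s. ennreal (kernel p s x) * indicator B s \<partial>lborel)" for x
    have [measurable]: "k \<in> borel_measurable borel" unfolding k_def by measurable
    have k: "emeasure (step p x) B = k x" if "x \<in> {0<..<1}" for x
      using that by (simp add: k_def step_eq_density emeasure_density)
    have meas: "ennreal (measure (step p (X t \<omega>)) B) = k (X t \<omega>)" if "\<omega> \<in> space M" for \<omega>
    proof -
      interpret step: prob_space "step p (X t \<omega>)" by (rule prob_space_step[OF range[OF that]])
      show ?thesis using k[OF range[OF that, of t]] by (simp add: step.emeasure_eq_measure)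
    qed
    let ?f = "\<lambda>\<omega>. indicator B (X (Suc t) \<omega>) :: real"
    have int: "integrable M ?f"
      by (rule integrable_const_bound[of _ 1]) auto
    have "emeasure (distr M borel (X (Suc t))) B = (\<integral>\<^sup>+x. indicator B x \<partial>distr M borel (X (Suc t)))"
      by simp
    also have "\<dots> = (\<integral>\<^sup>+\<omega>. ennreal (?f \<omega>) \<partial>M)"
      by (subst nn_integral_distr) (auto simp: ennreal_indicator)
    also have "\<dots> = ennreal (\<integral>\<omega>. ?f \<omega> \<partial>M)"
      by (intro nn_integral_eq_integral int) auto
    also have "\<dots> = ennreal (\<integral>\<omega>. real_cond_exp M (history M X t) ?f \<omega> \<partial>M)"
      using H.real_cond_exp_int(2)[OF int] by simp
    \<comment> \<open>The conditional expectation is nonnegative almost surely because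
      \<open>cond\<close> identifies it with a value of a measure.\<close>
    also have "\<dots> = (\<integral>\<^sup>+\<omega>. ennreal (real_cond_exp M (history M X t) ?f \<omega>) \<partial>M)"
      using cond[OF that] H.real_cond_exp_int(1)[OF int]
      by (intro nn_integral_eq_integral[symmetric]) (auto elim!: eventually_mono)
    also have "\<dots> = (\<integral>\<^sup>+\<omega>. k (X t \<omega>) \<partial>M)"
      by (rule nn_integral_cong_AE) (use cond[OF that] AE_space in \<open>eventually_elim, simp add: meas\<close>)
    also have "\<dots> = (\<integral>\<^sup>+x. k x \<partial>distr M borel (X t))"
      by (simp add: nn_integral_distr)
    also have "\<dots> = (\<integral>\<^sup>+x. emeasure (step p x) B \<partial>distr M borel (X t))"
    proof (rule nn_integral_cong_AE)
      have "AE x in distr M borel (X t). x \<in> {0<..<1}"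
        using on by (simp only: on_unit_interval_def)
      then show "AE x in distr M borel (X t). k x = emeasure (step p x) B"
        by eventually_elim (simp only: k)
    qed
    finally show ?thesis .
  qed
  with on show ?thesis by (simp add: evolves_def)
qed

theorem theorem3p2:
  fixes p :: real
  assumes "p > 0"
  shows "\<exists>Z::real. 2 * ln 2 < Z \<and> Z < pi \<and>
    stationary_density p (rho p Z) \<and>
    (\<forall>\<mu>. stationary_distribution p \<mu> \<longleftrightarrow> \<mu> = density lborel (rho p Z)) \<and>
    (\<forall>(M :: 'a measure) X. markov_chain p M X \<longrightarrow>
       (\<lambda>t. tv_dist (distr M borel (X t)) (density lborel (rho p Z))) \<longlonglongrightarrow> 0)"
proof (intro exI[of _ "mass p"] conjI allI impI)
  let ?\<rho> = "density lborel (rho p (mass p))"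
  show "2 * ln 2 < mass p" "mass p < pi"
    using mass_bounds[OF assms] .
  show "stationary_density p (rho p (mass p))"
    by (rule stationary_density_rho[OF assms])
  show "stationary_distribution p \<mu> \<longleftrightarrow> \<mu> = ?\<rho>" for \<mu>
  proof
    assume "stationary_distribution p \<mu>"
    then have ev: "evolves p \<mu> \<mu>" by (simp add: stationary_distribution_iff_evolves)
    then have sets: "sets \<mu> = sets borel" and "prob_space \<mu>"
      by (auto simp: evolves_def on_unit_interval_def)
    interpret \<mu>: prob_space \<mu> by fact
    interpret \<rho>: prob_space ?\<rho> by (rule prob_space_rho[OF assms])
    show "\<mu> = ?\<rho>"
    proof (rule measure_eqI)
      fix B assume "B \<in> sets \<mu>"
      \<comment> \<open>Two stationary laws are compared as constant sequences: the left side does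
        not depend on \<open>t\<close>, so it is at most the limit 0.\<close>
      then have "\<bar>measure \<mu> B - measure ?\<rho> B\<bar> \<le> (1 - (1 / 3) powr p / 6) ^ t" for t
        using evolves_measure_bound[OF assms ev rho_evolves[OF assms], of B t] sets by simp
      then have "\<bar>measure \<mu> B - measure ?\<rho> B\<bar> \<le> 0"
        by (intro LIMSEQ_le_const[OF contraction_rate_tendsto[OF assms]]) auto
      then show "emeasure \<mu> B = emeasure ?\<rho> B"
        by (simp add: \<mu>.emeasure_eq_measure \<rho>.emeasure_eq_measure)
    qed (simp add: sets)
  qed (simp add: stationary_distribution_iff_evolves rho_evolves[OF assms])
  fix M :: "'a measure" and X
  assume "markov_chain p M X"
  note ev = markov_chain_evolves[OF this]
  have bound: "\<bar>measure (distr M borel (X t)) B - measure ?\<rho> B\<bar> \<le> (1 - (1 / 3) powr p / 6) ^ t"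
    if "B \<in> sets borel" for B t
    using evolves_measure_bound[of p "\<lambda>t. distr M borel (X t)" "\<lambda>t. ?\<rho>" B t, OF assms ev rho_evolves[OF assms] that] .
  show "(\<lambda>t. tv_dist (distr M borel (X t)) ?\<rho>) \<longlonglongrightarrow> 0"
  proof (rule tendsto_sandwich[OF _ _ tendsto_const contraction_rate_tendsto[OF assms]])
    show "\<forall>\<^sub>F t in sequentially. tv_dist (distr M borel (X t)) ?\<rho> \<le> (1 - (1 / 3) powr p / 6) ^ t"
      unfolding tv_dist_def using bound by (intro always_eventually allI cSUP_least) auto
    have "0 \<le> tv_dist (distr M borel (X t)) ?\<rho>" for t
    proof -
      \<comment> \<open>The empty set contributes 0 to the supremum, and \<open>bound\<close>
        supplies the boundedness from above that a real supremum requires.\<close>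
      have "\<bar>measure (distr M borel (X t)) {} - measure ?\<rho> {}\<bar> \<le> tv_dist (distr M borel (X t)) ?\<rho>"
        unfolding tv_dist_def using bound[of _ t] by (intro cSUP_upper bdd_aboveI2) auto
      then show ?thesis by simp
    qed
    then show "\<forall>\<^sub>F t in sequentially. 0 \<le> tv_dist (distr M borel (X t)) ?\<rho>" by simp
  qed
qed

end
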